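(* Let $M=2$, $K=3$, and let $N\ge 7$ be an odd integer. Let $A\in\mathbb{R}^{2\times N}$ be the matrix whose $i$-th column is $(\cos\theta_i,\sin\theta_i)^T$ with $$\theta_i=\frac{2\pi(i-1)}{N+1}\bmod\pi,\qquad 1\le i\le N.$$ Then this set of angles minimizes the maximum condition number among all submatrices with $K=3$ columns. That is, for every matrix $B\in\mathbb{R}^{2\times N}$ all of whose columns have unit $\ell_2$ norm, $$\max_{S\subseteq\{1,\dots,N\},\,|S|=3}\kappa(A_S)\;\le\;\max_{S\subseteq\{1,\dots,N\},\,|S|=3}\kappa(B_S).$$
   Context: For a matrix $B\in\mathbb{R}^{2\times N}$ and a subset $S\subseteq\{1,\dots,N\}$ with $|S|=3$, $B_S\in\mathbb{R}^{2\times 3}$ denotes the submatrix consisting of the columns of $B$ indexed by $S$. The condition number of a $2\times 3$ matrix $C$ is $\kappa(C)=\sigma_{\max}(C)/\sigma_{\min}(C)$, where $\sigma_{\max}(C)\ge\sigma_{\min}(C)\ge 0$ are its two singular values (the square roots of the two eigenvalues of $CC^T$), with $\kappa(C)=+\infty$ if $\sigma_{\min}(C)=0$. For a real number $x$, $x\bmod\pi$ denotes the representative of $x$ modulo $\pi$ in $[0,\pi)$. *)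

theory Defs
  imports
    "HOL-Library.Extended_Real"
    "HOL-Library.Real_Mod"
    "Jordan_Normal_Form.Spectral_Radius"
    "Jordan_Normal_Form.DL_Submatrix"
begin

text \<open>
  For a wide matrix (at least as many columns as rows): the square roots of the eigenvalues
  of \<open>C C\<^sup>T\<close>. Multiplicities are dropped, which does not affect the largest and the smallest one.
\<close>

definition singular_values :: "real mat \<Rightarrow> real set" where
  "singular_values C = sqrt ` spectrum (C * C\<^sup>T)"

definition sigma_max :: "real mat \<Rightarrow> real" where
  "sigma_max C = Max (singular_values C)"

definition sigma_min :: "real mat \<Rightarrow> real" where
  "sigma_min C = Min (singular_values C)"

definition cond_number :: "real mat \<Rightarrow> ereal" where
  "cond_number C = (if sigma_min C = 0 then \<infinity> else ereal (sigma_max C / sigma_min C))"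

text \<open>Columns are indexed by \<open>0, \<dots>, N - 1\<close>; all rows are kept.\<close>

definition max_cond_number :: "nat \<Rightarrow> real mat \<Rightarrow> ereal" where
  "max_cond_number K B =
     Max {cond_number (submatrix B UNIV S) | S. S \<subseteq> {..<dim_col B} \<and> card S = K}"

definition vec_l2_norm :: "real vec \<Rightarrow> real" where
  "vec_l2_norm v = sqrt (v \<bullet> v)"

definition angle :: "nat \<Rightarrow> nat \<Rightarrow> real" where
  "angle N i = (2 * pi * (real i - 1) / (real N + 1)) rmod pi"

text \<open>
  The angles are numbered from \<open>1\<close>, the matrix columns from \<open>0\<close>: column \<open>j\<close> carries the
  angle with number \<open>j + 1\<close>.
\<close>

definition angle_matrix :: "nat \<Rightarrow> real mat" where
  "angle_matrix N = mat 2 N (\<lambda>(r, j). if r = 0 then cos (angle N (j + 1)) else sin (angle N (j + 1)))"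

end

theory Submission
  imports Defs "HOL-Analysis.Complex_Transcendental"
begin

text \<open>
  Squaring the columns \<open>(x\<^sub>j, y\<^sub>j)\<close> as complex numbers gives points \<open>w\<^sub>j = (x\<^sub>j + \<i> y\<^sub>j)\<^sup>2\<close> of the unit
  circle, and the eigenvalues of the Gram matrix of the columns in \<open>S\<close> are \<open>(K \<plusminus> r) / 2\<close> with
  \<open>K = card S\<close> and \<open>r = cmod (\<Sum>j\<in>S. w\<^sub>j)\<close>. Hence one has to minimize the largest \<open>r\<close> over all triples.

  Write \<open>N = 2 m - 1\<close> and \<open>\<alpha> = 2 \<pi> / m\<close>. The special angles give a regular \<open>m\<close>-gon with all vertices but one
  doubled, for which \<open>r\<^sup>2 \<le> 5 + 4 cos \<alpha>\<close>. In an arbitrary configuration let \<open>t\<close> be the smallest gap between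
  cyclically consecutive points and put \<open>k = \<alpha> - (1 - 1 / m) t\<close>. If two consecutive gaps have sum at most
  \<open>t + k\<close>, then they span a triple with \<open>r\<^sup>2 \<ge> 5 + 4 cos \<alpha>\<close>. Otherwise the smallest gap, its two neighbours
  (each \<open>> k\<close>), and the remaining gaps, grouped into \<open>m - 2\<close> pairs, have a sum exceeding
  \<open>t + 2 k + (m - 2) (t + k) = 2 \<pi>\<close>, which is impossible.
\<close>

section \<open>Trigonometric inequalities for two consecutive gaps\<close>

text \<open>Three unit vectors separated by successive angles \<open>x\<close> and \<open>y\<close>
  have a sum of squared length \<open>3 + 2 * gap_cos x y\<close>.\<close>

definition gap_cos :: "real \<Rightarrow> real \<Rightarrow> real" where
  "gap_cos x y = cos x + cos y + cos (x + y)"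

lemma gap_cos_half:
  "gap_cos x y = 2 * cos ((x + y) / 2) * cos ((x - y) / 2) + 2 * (cos ((x + y) / 2))\<^sup>2 - 1"
proof -
  have two: "(2 :: real) \<noteq> 0" by simp
  have "cos (x + y) = 2 * (cos ((x + y) / 2))\<^sup>2 - 1"
    using cos_double_cos[of "(x + y) / 2"] unfolding nonzero_mult_div_cancel_left[OF two] times_divide_eq_right .
  then show ?thesis
    unfolding gap_cos_def using cos_plus_cos[of x y] by simp
qed

text \<open>For a fixed sum of the gaps, the value is least when one of them is as small as possible.\<close>

lemma gap_cos_mono:
  assumes "0 \<le> t" "t \<le> x" "t \<le> y" "x + y \<le> t + k" "t + k \<le> pi"
  shows "gap_cos t k \<le> gap_cos x y"
proof -
  have s: "cos ((t + k) / 2) \<le> cos ((x + y) / 2)" "0 \<le> cos ((t + k) / 2)"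
    using assms by (auto intro!: cos_monotone_0_pi_le cos_ge_zero)
  \<comment> \<open>The distance of \<open>x\<close> and \<open>y\<close> is
    \<open>x + y - 2 * min x y\<close>, which is at most \<open>(t + k) - 2 * t\<close>.\<close>
  have "cos ((k - t) / 2) \<le> cos (\<bar>x - y\<bar> / 2)" "0 \<le> cos ((k - t) / 2)"
    using assms by (auto intro!: cos_monotone_0_pi_le cos_ge_zero)
  moreover have "cos (\<bar>x - y\<bar> / 2) = cos ((x - y) / 2)"
    using cos_abs_real[of "(x - y) / 2"] by simp
  moreover have "cos ((k - t) / 2) = cos ((t - k) / 2)"
    using cos_minus[of "(t - k) / 2"] by (simp add: minus_divide_left)
  ultimately have d: "cos ((t - k) / 2) \<le> cos ((x - y) / 2)" "0 \<le> cos ((t - k) / 2)"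
    by simp_all
  show ?thesis
    unfolding gap_cos_half using s d by (simp add: mult_mono power_mono add_mono)
qed

lemma cos_le_quartic: "cos x \<le> 1 - x\<^sup>2 / 2 + x ^ 4 / 24" for x :: real
proof -
  obtain u where "cos x = (\<Sum>m<4. cos_coeff m * x ^ m) + cos (u + 1 / 2 * real 4 * pi) / fact 4 * x ^ 4"
    using Maclaurin_cos_expansion[of x 4] by blast
  then have u: "cos x = 1 - x\<^sup>2 / 2 + cos (u + 2 * pi) * (x ^ 4 / 24)"
    by (simp add: cos_coeff_def fact_numeral lessThan_nat_numeral)
  have "cos (u + 2 * pi) * (x ^ 4 / 24) \<le> 1 * (x ^ 4 / 24)"
    by (intro mult_right_mono) auto
  then show ?thesis using u by simp
qed

lemma cos_ge_quadratic: "1 - x\<^sup>2 / 2 \<le> cos x" for x :: real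
proof -
  obtain u where "cos x = (\<Sum>m<2. cos_coeff m * x ^ m) + cos (u + 1 / 2 * real 2 * pi) / fact 2 * x ^ 2"
    using Maclaurin_cos_expansion[of x 2] by blast
  then have u: "cos x = 1 + cos (u + pi) * (x\<^sup>2 / 2)"
    by (simp add: cos_coeff_def eval_nat_numeral lessThan_Suc)
  have "- 1 * (x\<^sup>2 / 2) \<le> cos (u + pi) * (x\<^sup>2 / 2)"
    by (intro mult_right_mono) (auto simp del: cos_periodic_pi)
  then show ?thesis using u by simp
qed

text \<open>
  With \<open>q = cos (2 \<pi> / 7)\<close>, the equation \<open>cos (4 \<cdot> 2 \<pi> / 7) = cos (3 \<cdot> 2 \<pi> / 7)\<close> gives
  \<open>(q\<^sup>2 + q - 1) (8 q - 4) = 5 - 8 q\<close>.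
\<close>

lemma cos_two_pi_div_7: "0 \<le> (cos (2 * pi / 7))\<^sup>2 + cos (2 * pi / 7) - 1"
proof -
  define q where "q = cos (2 * pi / 7)"
  have q: "1 / 2 < q" "q < 1"
    using cos_monotone_0_pi[of "2 * pi / 7" "pi / 3"] cos_monotone_0_pi[of 0 "2 * pi / 7"]
    by (auto simp: q_def cos_60)
  have "cos (2 * (2 * (2 * pi / 7))) = cos (3 * (2 * pi / 7))"
    using cos_2pi_minus[of "3 * (2 * pi / 7)"] by (simp add: field_simps)
  then have "2 * (2 * q\<^sup>2 - 1)\<^sup>2 - 1 = 4 * q ^ 3 - 3 * q"
    unfolding cos_double_cos cos_treble_cos q_def .
  then have "(q - 1) * (8 * q ^ 3 + 4 * q\<^sup>2 - 4 * q - 1) = 0"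
    by (simp add: algebra_simps power2_eq_square power3_eq_cube)
  then have "8 * q ^ 3 + 4 * q\<^sup>2 - 4 * q - 1 = 0"
    using q by simp
  then have e: "(q\<^sup>2 + q - 1) * (8 * q - 4) = 5 - 8 * q"
    by (simp add: algebra_simps power2_eq_square power3_eq_cube)
  show ?thesis
  proof (rule ccontr)
    assume "\<not> ?thesis"
    then have neg: "q\<^sup>2 + q - 1 < 0" by (simp add: q_def)
    then have "(q\<^sup>2 + q - 1) * (8 * q - 4) < 0"
      using q by (intro mult_neg_pos) auto
    then have "5 / 8 < q" using e by simp
    \<comment> \<open>Hence \<open>q\<^sup>2 + q\<close> exceeds \<open>25 / 64 + 40 / 64\<close>,
      which is more than 1.\<close>
    then have "(5 / 8) * (5 / 8) < q * q" by (intro mult_strict_mono) auto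
    then show False using neg \<open>5 / 8 < q\<close> by (simp add: power2_eq_square)
  qed
qed

text \<open>
  This is where \<open>N \<ge> 7\<close> enters: the inequality fails for \<open>m = 3\<close>. The case \<open>m = 4\<close> is too tight
  for the Taylor estimate used for \<open>m \<ge> 5\<close>.
\<close>

lemma gap_cos_equal_gaps:
  assumes "m \<ge> 4"
  defines "g \<equiv> 2 * pi / (2 * real m - 1)"
  shows "1 + 2 * cos (2 * pi / real m) \<le> gap_cos g g"
proof -
  \<comment> \<open>Half of the claim, as
    \<open>gap_cos g g = 2 * (cos g)\<^sup>2 + 2 * cos g - 1\<close>.\<close>
  have "cos (2 * pi / real m) \<le> (cos g)\<^sup>2 + cos g - 1"
  proof (cases "m = 4")
    case True
    have "cos (2 * pi / 4) = 0" using cos_pi_half by (simp add: field_simps)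
    then show ?thesis using cos_two_pi_div_7 True by (simp add: g_def)
  next
    case False
    then have m: "5 \<le> real m" using assms(1) by simp
    have g: "0 < g" "g \<le> 7 / 10"
      using m pi_approx(2) by (auto simp: g_def divide_simps)
    \<comment> \<open>\<open>2 * pi / m\<close> equals \<open>(2 - 1 / m) * g\<close>, and the
      factor is at least \<open>9 / 5\<close> for \<open>m \<ge> 5\<close>.\<close>
    have "9 / 5 * g \<le> 2 * pi / real m"
      using m by (simp add: g_def field_simps)
    moreover have "2 * pi / real m \<le> pi" using m by (simp add: field_simps)
    ultimately have "cos (2 * pi / real m) \<le> cos (9 / 5 * g)"
      using g by (intro cos_monotone_0_pi_le) auto
    also have "\<dots> \<le> 1 - 81 / 50 * g\<^sup>2 + 2187 / 5000 * g ^ 4"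
      using cos_le_quartic[of "9 / 5 * g"] by (simp add: power_mult_distrib power_divide)
    \<comment> \<open>The target polynomial is what \<open>1 - g\<^sup>2 / 2 \<le> cos g\<close>
      yields on the right. The spare \<open>3 / 25 * g\<^sup>2\<close> absorbs the excess in the
      quartic term.\<close>
    also have "\<dots> \<le> 1 - 3 / 2 * g\<^sup>2 + g ^ 4 / 4"
    proof -
      have "g\<^sup>2 \<le> (7 / 10)\<^sup>2" using g by (intro power_mono) auto
      then have "g\<^sup>2 * g\<^sup>2 \<le> 49 / 100 * g\<^sup>2"
        by (intro mult_right_mono) (auto simp: power2_eq_square)
      moreover have "g ^ 4 = g\<^sup>2 * g\<^sup>2" by (simp add: power_add[symmetric])
      moreover have "0 \<le> g\<^sup>2" by simp
      ultimately show ?thesis by linarith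
    qed
    also have "\<dots> \<le> (cos g)\<^sup>2 + cos g - 1"
    proof -
      have "g\<^sup>2 \<le> 1" using g by (simp add: power_le_one)
      then have "(1 - g\<^sup>2 / 2)\<^sup>2 \<le> (cos g)\<^sup>2"
        using cos_ge_quadratic[of g] by (intro power_mono) auto
      moreover have "(1 - g\<^sup>2 / 2)\<^sup>2 = 1 - g\<^sup>2 + g ^ 4 / 4"
        by (simp add: power2_eq_square power4_eq_xxxx field_simps)
      ultimately show ?thesis using cos_ge_quadratic[of g] by simp
    qed
    finally show ?thesis .
  qed
  moreover have "cos (g + g) = 2 * (cos g)\<^sup>2 - 1"
    using cos_double_cos[of g] unfolding mult_2 .
  ultimately show ?thesis unfolding gap_cos_def by simp
qed

text \<open>
  The left-hand side is the value at \<open>t = 0\<close>; the right endpoint \<open>t = 2 \<pi> / (2 m - 1)\<close> is the case of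
  equal gaps, and in between the function is concave.
\<close>

lemma gap_cos_segment:
  assumes m: "m \<ge> 4" and t: "0 \<le> t" "t \<le> 2 * pi / (2 * real m - 1)"
  shows "1 + 2 * cos (2 * pi / real m) \<le> gap_cos t (2 * pi / real m - (1 - 1 / real m) * t)"
proof -
  define a where "a = 2 * pi / real m"
  define g where "g = 2 * pi / (2 * real m - 1)"
  define r where "r = 1 - 1 / real m"
  define F where "F t = gap_cos t (a - r * t)" for t
  have m4: "4 \<le> real m" using m by simp
  have r: "3 / 4 \<le> r" "r \<le> 1" using m4 by (auto simp: r_def field_simps)
  have g_pos: "0 < g" using m4 by (simp add: g_def)
  have F: "F t = cos t + cos (a - r * t) + cos (a + (1 - r) * t)" for t
    by (simp add: F_def gap_cos_def algebra_simps)
  have "concave_on {0..g} F"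
  proof (rule f''_le0_imp_concave)
    fix x assume x: "x \<in> {0..g}"
    let ?F1 = "\<lambda>x. - sin x + r * sin (a - r * x) - (1 - r) * sin (a + (1 - r) * x)"
    let ?F2 = "\<lambda>x. - cos x - r * r * cos (a - r * x) - (1 - r) * (1 - r) * cos (a + (1 - r) * x)"
    show "(F has_real_derivative ?F1 x) (at x)"
      unfolding F[abs_def] by (rule derivative_eq_intros refl | simp)+
    show "(?F1 has_real_derivative ?F2 x) (at x)"
      by (rule derivative_eq_intros refl | simp)+
    \<comment> \<open>In the negated second derivative the first term is at least 1/2, the second is
      nonnegative, and the third is at least -1/16 because \<open>1 - r \<le> 1 / 4\<close>.\<close>
    have "2 * pi / (2 * real m - 1) \<le> 2 * pi / 6"
      using m4 by (intro divide_left_mono) auto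
    then have "x \<le> pi / 3"
      using x by (simp add: g_def)
    then have "1 / 2 \<le> cos x"
      using x cos_monotone_0_pi_le[of x "pi / 3"] by (simp add: cos_60)
    moreover have "0 \<le> cos (a - r * x)"
    proof (rule cos_ge_zero)
      have "2 * pi / real m \<le> 2 * pi / 4"
        using m4 by (intro divide_left_mono) auto
      moreover have "0 \<le> r * x" using x r by simp
      ultimately show "a - r * x \<le> pi / 2" by (simp add: a_def)
      have "r * x \<le> 1 * x" using x r by (intro mult_right_mono) auto
      moreover have "0 \<le> a" by (simp add: a_def)
      ultimately show "- (pi / 2) \<le> a - r * x"
        using \<open>x \<le> pi / 3\<close> pi_gt_zero by linarith
    qed
    then have "0 \<le> r * r * cos (a - r * x)"
      using r by simp
    moreover have "- (1 / 2) \<le> (1 - r) * (1 - r) * cos (a + (1 - r) * x)"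
    proof -
      have "(1 - r) * (1 - r) \<le> 1 / 4 * (1 / 4)"
        using r by (intro mult_mono) auto
      moreover have "(1 - r) * (1 - r) * - 1 \<le> (1 - r) * (1 - r) * cos (a + (1 - r) * x)"
        by (intro mult_left_mono) auto
      ultimately show ?thesis by linarith
    qed
    ultimately show "?F2 x \<le> 0" by linarith
  qed simp
  then have "(1 - t / g) * F 0 + (t / g) * F g \<le> F ((1 - t / g) *\<^sub>R 0 + (t / g) *\<^sub>R g)"
    using t g_pos by (intro concave_onD) (auto simp: g_def[symmetric])
  then have conc: "(1 - t / g) * F 0 + (t / g) * F g \<le> F t"
    using g_pos by simp
  have F0: "F 0 = 1 + 2 * cos a" by (simp add: F)
  have "a - r * g = g" using m4 by (simp add: a_def g_def r_def field_simps)
  then have Fg: "1 + 2 * cos a \<le> F g"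
    using gap_cos_equal_gaps[OF m] by (simp add: F_def a_def g_def)
  have "(t / g) * (1 + 2 * cos a) \<le> (t / g) * F g"
    using Fg t g_pos by (intro mult_left_mono) auto
  then have "1 + 2 * cos a \<le> (1 - t / g) * F 0 + (t / g) * F g"
    unfolding F0 by (simp add: algebra_simps)
  with conc show ?thesis by (simp add: F_def a_def r_def)
qed

section \<open>A clustered triple in an arbitrary configuration\<close>

text \<open>The circle is unrolled: \<open>P\<close> lists the points in cyclic order, and each full
  turn adds \<open>2 * pi\<close>. Gaps across the starting point thus need no separate
  treatment.\<close>

lemma consecutive_gaps_small:
  fixes P :: "nat \<Rightarrow> real"
  assumes m: "m \<ge> 4"
    and mono: "\<And>i. P i \<le> P (Suc i)"
    and periodic: "\<And>i. P (i + (2 * m - 1)) = P i + 2 * pi"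
  shows "\<exists>i. 1 + 2 * cos (2 * pi / real m)
             \<le> gap_cos (P (Suc i) - P i) (P (Suc (Suc i)) - P (Suc i))"
proof (rule ccontr)
  assume "\<not> ?thesis"
  then have lt: "gap_cos (P (Suc i) - P i) (P (Suc (Suc i)) - P (Suc i)) < 1 + 2 * cos (2 * pi / real m)" for i
    by (meson not_le)
  define N where "N = 2 * m - 1"
  define G where "G i = P (Suc i) - P i" for i
  have m4: "4 \<le> real m" using m by simp
  have N: "0 < N" "real N = 2 * real m - 1" using m by (auto simp: N_def of_nat_diff)
  have per: "P (i + N) = P i + 2 * pi" for i
    using periodic by (simp add: N_def)
  have G_per: "G (i + N) = G i" for i
    using per[of i] per[of "Suc i"] by (simp add: G_def)
  have G_per': "G (i + l * N) = G i" for i l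
  proof (induction l)
    case (Suc l)
    then show ?case using G_per[of "i + l * N"] by (simp add: add_ac)
  qed simp
  have G_mod: "G i = G (i mod N)" for i
    using G_per'[of "i mod N" "i div N"] by (simp add: mult.commute)
  obtain i0 where i0: "\<And>i. i < N \<Longrightarrow> G i0 \<le> G i"
  proof -
    have "Min (G ` {..<N}) \<in> G ` {..<N}" using N by (intro Min_in) auto
    then obtain i0 where "Min (G ` {..<N}) = G i0" by auto
    moreover have "Min (G ` {..<N}) \<le> G i" if "i < N" for i
      using that by (intro Min_le) auto
    ultimately show ?thesis using that by metis
  qed
  define t where "t = G i0"
  have t_min: "t \<le> G i" for i
    using i0[of "i mod N"] N G_mod[of i] by (simp add: t_def)
  have t_nonneg: "0 \<le> t" using mono[of i0] by (simp add: t_def G_def)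
  \<comment> \<open>The gaps of one period average \<open>2 * pi / N\<close>, which puts
    \<open>t\<close> in the range of \<open>gap_cos_segment\<close>.\<close>
  have "real n * t \<le> P n - P 0" for n
  proof (induction n)
    case (Suc n)
    then show ?case using t_min[of n] by (simp add: G_def algebra_simps)
  qed simp
  from this[of N] have "real N * t \<le> 2 * pi" using per[of 0] by simp
  then have t_le: "t \<le> 2 * pi / (2 * real m - 1)"
    using m4 N by (simp add: field_simps)
  \<comment> \<open>This \<open>k\<close> solves
    \<open>t + 2 * k + (m - 2) * (t + k) = 2 * pi\<close>, the budget of one full turn.\<close>
  define k where "k = 2 * pi / real m - (1 - 1 / real m) * t"
  have key: "1 + 2 * cos (2 * pi / real m) \<le> gap_cos t k"
    unfolding k_def using m t_nonneg t_le by (rule gap_cos_segment)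
  have tk_le: "t + k \<le> pi"
  proof -
    have "2 * pi / (2 * real m - 1) \<le> 2 * pi / 6"
      using m4 by (intro divide_left_mono) auto
    moreover have "2 * pi / real m \<le> 2 * pi / 4"
      using m4 by (intro divide_left_mono) auto
    moreover have "t / real m \<le> t / 4"
      using m4 t_nonneg by (intro divide_left_mono) auto
    moreover have "t + k = 2 * pi / real m + t / real m"
      by (simp add: k_def algebra_simps)
    ultimately show ?thesis using t_le pi_gt_zero by linarith
  qed
  have pair: "t + k < G i + G (Suc i)" for i
  proof (rule ccontr)
    assume "\<not> ?thesis"
    then have "gap_cos t k \<le> gap_cos (G i) (G (Suc i))"
      using t_nonneg t_min tk_le by (intro gap_cos_mono) auto
    with key lt[of i] show False by (simp add: G_def)
  qed
  have pairs: "P i + real l * (t + k) \<le> P (i + 2 * l)" for i l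
  proof (induction l)
    case (Suc l)
    then show ?case using pair[of "i + 2 * l"] by (simp add: G_def algebra_simps)
  qed simp
  \<comment> \<open>\<open>j\<close> precedes a copy of the smallest gap; the shift by a period
    avoids truncated subtraction when \<open>i0 = 0\<close>.\<close>
  define j where "j = i0 + N - 1"
  have j: "Suc j = i0 + N" using N by (simp add: j_def)
  have "G (Suc j) = t" unfolding j G_per by (simp add: t_def)
  \<comment> \<open>Both pairs containing the smallest gap exceed \<open>t + k\<close>, so both its
    neighbours exceed \<open>k\<close>. The other \<open>N - 3 = 2 * (m - 2)\<close> gaps form
    consecutive pairs.\<close>
  then have "P j + 2 * k + t < P (j + 3)"
    using pair[of j] pair[of "Suc j"] by (simp add: G_def eval_nat_numeral)
  moreover have "P (j + 3) + real (m - 2) * (t + k) \<le> P (j + N)"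
  proof -
    have eq: "j + 3 + 2 * (m - 2) = j + N" using m by (simp add: N_def)
    show ?thesis using pairs[of "j + 3" "m - 2"] unfolding eq .
  qed
  ultimately have "2 * k + t + (real m - 2) * (t + k) < 2 * pi"
    using per[of j] m by (simp add: of_nat_diff)
  moreover have "2 * k + t + (real m - 2) * (t + k) = 2 * pi"
    using m4 by (simp add: k_def field_simps)
  ultimately show False by simp
qed

lemma cmod_sum_three_cis:
  "(cmod (cis x + cis y + cis z))\<^sup>2 = 3 + 2 * (cos (x - y) + cos (y - z) + cos (x - z))"
proof -
  have expand: "(a + b + c)\<^sup>2 + (d + e + f)\<^sup>2 = (a\<^sup>2 + d\<^sup>2) + (b\<^sup>2 + e\<^sup>2) + (c\<^sup>2 + f\<^sup>2)
      + 2 * ((a * b + d * e) + (b * c + e * f) + (a * c + d * f))" for a b c d e f :: real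
    by (simp add: power2_eq_square algebra_simps)
  have "(cmod (cis x + cis y + cis z))\<^sup>2
      = (cos x + cos y + cos z)\<^sup>2 + (sin x + sin y + sin z)\<^sup>2"
    by (simp add: cmod_power2)
  then show ?thesis
    unfolding expand cos_diff by simp
qed

lemma exists_clustered_triple:
  fixes \<phi> :: "nat \<Rightarrow> real"
  assumes m: "m \<ge> 4" and \<phi>: "\<And>j. j < 2 * m - 1 \<Longrightarrow> - pi < \<phi> j \<and> \<phi> j \<le> pi"
  obtains S where "S \<subseteq> {..<2 * m - 1}" "card S = 3"
    "5 + 4 * cos (2 * pi / real m) \<le> (cmod (\<Sum>j\<in>S. cis (\<phi> j)))\<^sup>2"
proof -
  define N where "N = 2 * m - 1"
  define xs where "xs = sort_key \<phi> [0..<N]"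
  have N: "7 \<le> N" using m by (simp add: N_def)
  have xs: "length xs = N" "distinct xs" "sorted (map \<phi> xs)" "set xs = {..<N}"
    by (auto simp: xs_def)
  have xs_less: "xs ! (i mod N) < N" for i
  proof -
    have "xs ! (i mod N) \<in> set xs" using N xs(1) by (intro nth_mem) simp
    then show ?thesis using xs(4) by simp
  qed
  \<comment> \<open>The sorted arguments are continued periodically; \<open>i div N\<close> counts
    completed turns. At a wrap-around, monotonicity holds because all arguments lie in an interval
    of length \<open>2 * pi\<close>.\<close>
  define P where "P i = \<phi> (xs ! (i mod N)) + 2 * pi * real (i div N)" for i
  have cis_P: "cis (P i) = cis (\<phi> (xs ! (i mod N)))" for i
    by (simp add: P_def cis_mult[symmetric] cis_multiple_2pi)
  have mono: "P i \<le> P (Suc i)" for i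
  proof (cases "Suc (i mod N) = N")
    case True
    then have "Suc i mod N = 0" "Suc i div N = Suc (i div N)"
      by (auto simp: mod_Suc div_Suc)
    moreover have "\<phi> (xs ! (i mod N)) \<le> pi" "- pi < \<phi> (xs ! 0)"
      using \<phi>[folded N_def] xs_less[of i] xs_less[of 0] by auto
    ultimately show ?thesis by (simp add: P_def algebra_simps)
  next
    case False
    then have s: "Suc i mod N = Suc (i mod N)" "Suc i div N = i div N"
      by (auto simp: mod_Suc div_Suc)
    have "i mod N < N" using N by simp
    then have "Suc (i mod N) < length xs" using False xs(1) by linarith
    then have "\<phi> (xs ! (i mod N)) \<le> \<phi> (xs ! Suc (i mod N))"
      using sorted_nth_mono[OF xs(3), of "i mod N" "Suc (i mod N)"] by simp
    then show ?thesis by (simp add: P_def s)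
  qed
  have "P (i + N) = P i + 2 * pi" for i
    using N by (simp add: P_def algebra_simps)
  then obtain i where i: "1 + 2 * cos (2 * pi / real m)
      \<le> gap_cos (P (Suc i) - P i) (P (Suc (Suc i)) - P (Suc i))"
    using consecutive_gaps_small[OF m, of P] mono unfolding N_def by blast
  define f where "f l = xs ! (l mod N)" for l
  have f_inj: "f k = f l \<longleftrightarrow> k mod N = l mod N" for k l
    using N xs(1,2) by (simp add: f_def nth_eq_iff_index_eq)
  \<comment> \<open>Only the column indices have to differ, and three consecutive residues modulo
    \<open>N\<close> do; the points themselves may coincide.\<close>
  have ne: "f i \<noteq> f (Suc i)" "f (Suc i) \<noteq> f (Suc (Suc i))" "f i \<noteq> f (Suc (Suc i))"
    unfolding f_inj using N by (auto simp: mod_Suc split: if_splits)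
  have "(cmod (\<Sum>j\<in>{f i, f (Suc i), f (Suc (Suc i))}. cis (\<phi> j)))\<^sup>2
      = (cmod (cis (P (Suc (Suc i))) + cis (P (Suc i)) + cis (P i)))\<^sup>2"
    using ne by (simp add: cis_P f_def add_ac)
  also have "\<dots> = 3 + 2 * gap_cos (P (Suc i) - P i) (P (Suc (Suc i)) - P (Suc i))"
    unfolding cmod_sum_three_cis gap_cos_def by (simp add: algebra_simps)
  finally have "5 + 4 * cos (2 * pi / real m) \<le> (cmod (\<Sum>j\<in>{f i, f (Suc i), f (Suc (Suc i))}. cis (\<phi> j)))\<^sup>2"
    using i by simp
  moreover have "{f i, f (Suc i), f (Suc (Suc i))} \<subseteq> {..<2 * m - 1}"
    unfolding N_def[symmetric] f_def using xs_less by auto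
  moreover have "card {f i, f (Suc i), f (Suc (Suc i))} = 3"
    using ne by simp
  ultimately show thesis using that by blast
qed

section \<open>Triples in the regular polygon with doubled vertices\<close>

text \<open>Among the vertices of a regular polygon other than 1, the neighbours of 1 have the
  largest real part. After reduction modulo \<open>m\<close>, a residue \<open>e\<close> beyond
  \<open>m / 2\<close> is reflected to \<open>m - e\<close>.\<close>

lemma cos_multiple_le:
  fixes d :: int
  assumes "0 < m" "\<not> int m dvd d"
  shows "cos (2 * pi * of_int d / real m) \<le> cos (2 * pi / real m)"
proof -
  define e where "e = d mod int m"
  have "e \<noteq> 0" "0 \<le> e" "e < int m" using assms by (auto simp: e_def dvd_eq_mod_eq_0)
  then have e: "1 \<le> real_of_int e" "real_of_int e \<le> real m - 1" by linarith+
  have "real_of_int d = real_of_int e + real m * of_int (d div int m)"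
    unfolding e_def by (metis add.commute mult_div_mod_eq of_int_add of_int_mult of_int_of_nat_eq)
  then have "2 * pi * of_int d / real m = 2 * pi * of_int e / real m + 2 * pi * of_int (d div int m)"
    using assms(1) by (simp add: field_simps)
  then have "cos (2 * pi * of_int d / real m) = cos (2 * pi * of_int e / real m)"
    by (simp add: cos_add sin_int_2pin cos_int_2pin)
  also have "\<dots> \<le> cos (2 * pi / real m)"
  proof (cases "2 * real_of_int e \<le> real m")
    case True
    then show ?thesis
      using e assms(1) by (intro cos_monotone_0_pi_le) (auto simp: field_simps)
  next
    case False
    have "cos (2 * pi * of_int e / real m) = cos (2 * pi * (real m - of_int e) / real m)"
      using cos_2pi_minus[of "2 * pi * of_int e / real m"] assms(1) by (simp add: field_simps)
    also have "\<dots> \<le> cos (2 * pi / real m)"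
    proof (rule cos_monotone_0_pi_le)
      have "2 * pi * 1 / real m \<le> 2 * pi * (real m - of_int e) / real m"
        using e by (intro divide_right_mono mult_left_mono) auto
      then show "2 * pi / real m \<le> 2 * pi * (real m - of_int e) / real m" by simp
      show "2 * pi * (real m - of_int e) / real m \<le> pi"
        using False assms(1) by (simp add: field_simps)
    qed simp
    finally show ?thesis .
  qed
  finally show ?thesis .
qed

text \<open>Each residue modulo \<open>m\<close> occurs at most twice below
  \<open>2 * m - 1\<close>, so at most one of the three pairs coincides. It contributes at most 1,
  and each other pair at most \<open>cos (2 * pi / m)\<close>.\<close>

lemma regular_triple_le:
  assumes m: "m \<ge> 1" and S: "S \<subseteq> {..<2 * m - 1}" "card S = 3"
  shows "(cmod (\<Sum>j\<in>S. cis (2 * pi * real j / real m)))\<^sup>2 \<le> 5 + 4 * cos (2 * pi / real m)"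
proof -
  obtain a b c where abc: "S = {a, b, c}" "a \<noteq> b" "b \<noteq> c" "a \<noteq> c"
    using S(2) by (metis card_3_iff)
  define C where "C i j = cos (2 * pi * real i / real m - 2 * pi * real j / real m)" for i j
  have C_le: "C i j \<le> cos (2 * pi / real m)" if "\<not> int m dvd int i - int j" for i j
    using cos_multiple_le[of m "int i - int j"] m that
    by (simp add: C_def right_diff_distrib diff_divide_distrib)
  have C_le_1: "C i j \<le> 1" for i j by (simp add: C_def)
  have not_both: "\<not> (int m dvd int x - int y \<and> int m dvd int y - int z)"
    if "{x, y, z} = S" "x \<noteq> y" "y \<noteq> z" "x \<noteq> z" for x y z
  proof
    assume "int m dvd int x - int y \<and> int m dvd int y - int z"
    then obtain k l where kl: "int x - int y = int m * k" "int y - int z = int m * l"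
      by (auto elim!: dvdE)
    have "x < 2 * m - 1" "y < 2 * m - 1" "z < 2 * m - 1" using that S by auto
    then have b: "int m * k < int m * 2" "int m * (- 2) < int m * k"
       "int m * l < int m * 2" "int m * (- 2) < int m * l"
       "int m * (k + l) < int m * 2" "int m * (- 2) < int m * (k + l)"
      using kl unfolding distrib_left kl[symmetric] by linarith+
    \<comment> \<open>If \<open>k\<close>, \<open>l\<close> and \<open>k + l\<close> are all
      nonzero, these bounds leave only 1 and -1 for each of them, but a sum of two such numbers is
      even.\<close>
    have "k < 2" "- 2 < k" "l < 2" "- 2 < l" "k + l < 2" "- 2 < k + l"
      using b m by (simp_all only: mult_less_cancel_left_pos of_nat_0_less_iff)
    moreover have "k \<noteq> 0" "l \<noteq> 0" "k + l \<noteq> 0"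
      using kl that by (auto simp: add_eq_0_iff)
    ultimately show False by linarith
  qed
  have sym: "int m dvd int i - int j \<longleftrightarrow> int m dvd int j - int i" for i j
    by (metis dvd_minus_iff minus_diff_eq)
  have "C a b + C b c + C a c \<le> 1 + 2 * cos (2 * pi / real m)"
    using not_both[of a b c] not_both[of b a c] not_both[of a c b] abc
      sym[of a b] sym[of b c] sym[of a c] C_le[of a b] C_le[of b c] C_le[of a c]
      C_le_1[of a b] C_le_1[of b c] C_le_1[of a c] cos_le_one[of "2 * pi / real m"]
    by (auto simp: insert_commute)
  moreover have "(cmod (\<Sum>j\<in>S. cis (2 * pi * real j / real m)))\<^sup>2 = 3 + 2 * (C a b + C b c + C a c)"
    using abc cmod_sum_three_cis by (simp add: C_def add.assoc)
  ultimately show ?thesis by simp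
qed

section \<open>Singular values of matrices with two rows\<close>

lemma det_2x2:
  fixes C :: "'a :: comm_ring_1 mat"
  assumes C: "C \<in> carrier_mat 2 2"
  shows "det C = C $$ (0, 0) * C $$ (1, 1) - C $$ (0, 1) * C $$ (1, 0)"
proof -
  have delete: "det (mat_delete C 0 j) = C $$ (1, 1 - j)" if "j < 2" for j
  proof -
    have "mat_delete C 0 j \<in> carrier_mat 1 1"
      using C by (intro carrier_matI) auto
    then have "det (mat_delete C 0 j) = mat_delete C 0 j $$ (0, 0)"
      by (rule det_single)
    also have "\<dots> = C $$ (1, 1 - j)"
      using C that by (cases j) (auto simp: mat_delete_def)
    finally show ?thesis .
  qed
  have "det C = (\<Sum>j<2. C $$ (0, j) * cofactor C 0 j)"
    using C by (rule laplace_expansion_row) simp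
  then show ?thesis
    by (simp add: numeral_2_eq_2 cofactor_def delete)
qed

lemma spectrum_2x2:
  fixes M :: "'a :: field mat"
  assumes "M \<in> carrier_mat 2 2"
  shows "spectrum M =
    {x. (M $$ (0, 0) - x) * (M $$ (1, 1) - x) - M $$ (0, 1) * M $$ (1, 0) = 0}"
proof -
  have "det (char_matrix M x) = (M $$ (0, 0) - x) * (M $$ (1, 1) - x) - M $$ (0, 1) * M $$ (1, 0)" for x
    using assms by (subst det_2x2) (auto simp: char_matrix_def)
  then show ?thesis
    unfolding spectrum_def eigenvalue_det[OF assms] by auto
qed

lemma bij_betw_pick: "finite S \<Longrightarrow> bij_betw (pick S) {..<card S} S"
  unfolding bij_betw_def
proof
  assume S: "finite S"
  show inj: "inj_on (pick S) {..<card S}"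
    by (rule inj_onI) (metis lessThan_iff linorder_neq_iff pick_mono_le)
  have "pick S ` {..<card S} \<subseteq> S"
    by (auto intro: pick_in_set_le)
  then show "pick S ` {..<card S} = S"
    using S inj by (intro card_subset_eq) (auto simp: card_image)
qed

lemma submatrix_UNIV_carrier:
  assumes "B \<in> carrier_mat n N" "S \<subseteq> {..<N}"
  shows "submatrix B UNIV S \<in> carrier_mat n (card S)"
proof -
  have "{j. j < dim_col B \<and> j \<in> S} = S" using assms by auto
  then show ?thesis
    using assms by (intro carrier_matI) (auto simp: dim_submatrix)
qed

lemma gram_submatrix_index:
  fixes B :: "'a :: comm_semiring_0 mat"
  assumes B: "B \<in> carrier_mat n N" and S: "S \<subseteq> {..<N}" and "i < n" "k < n"
  shows "(submatrix B UNIV S * (submatrix B UNIV S)\<^sup>T) $$ (i, k) = (\<Sum>j\<in>S. B $$ (i, j) * B $$ (k, j))"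
proof -
  have fin: "finite S" using S finite_subset by blast
  have cols: "{j. j < dim_col B \<and> j \<in> S} = S" using B S by auto
  have entry: "submatrix B UNIV S $$ (i, j) = B $$ (i, pick S j)" if "i < n" "j < card S" for i j
    using that B by (subst submatrix_index) (auto simp: cols pick_UNIV)
  have "(submatrix B UNIV S * (submatrix B UNIV S)\<^sup>T) $$ (i, k)
      = (\<Sum>j<card S. B $$ (i, pick S j) * B $$ (k, pick S j))"
    using submatrix_UNIV_carrier[OF B S] assms(3,4)
    by (simp add: scalar_prod_def entry lessThan_atLeast0)
  also have "\<dots> = (\<Sum>j\<in>S. B $$ (i, j) * B $$ (k, j))"
    using bij_betw_pick[OF fin] by (rule sum.reindex_bij_betw)
  finally show ?thesis .
qed

text \<open>Squaring doubles the angle, so a column and its negative, which contribute equally to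
  the Gram matrix, become the same point.\<close>

definition col_sq :: "real mat \<Rightarrow> nat \<Rightarrow> complex" where
  "col_sq B j = (Complex (B $$ (0, j)) (B $$ (1, j)))\<^sup>2"

lemma norm_col_sq:
  assumes "B \<in> carrier_mat 2 N" "j < N" "vec_l2_norm (col B j) = 1"
  shows "(B $$ (0, j))\<^sup>2 + (B $$ (1, j))\<^sup>2 = 1" "cmod (col_sq B j) = 1"
proof -
  have "{0..<2} = {0, 1 :: nat}" by auto
  then show *: "(B $$ (0, j))\<^sup>2 + (B $$ (1, j))\<^sup>2 = 1"
    using assms by (simp add: vec_l2_norm_def scalar_prod_def power2_eq_square)
  then show "cmod (col_sq B j) = 1"
    by (simp add: col_sq_def norm_power complex_norm)
qed

text \<open>The case \<open>r = K\<close> is that of a vanishing smaller eigenvalue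
  \<open>(K - r) / 2\<close>.\<close>

definition cond_fun :: "real \<Rightarrow> real \<Rightarrow> ereal" where
  "cond_fun K r = (if r = K then \<infinity> else ereal (sqrt ((K + r) / 2) / sqrt ((K - r) / 2)))"

lemma cond_fun_mono:
  assumes "0 \<le> r" "r \<le> s" "s \<le> K"
  shows "cond_fun K r \<le> cond_fun K s"
proof (cases "s = K")
  case False
  then show ?thesis
    using assms by (auto simp: cond_fun_def intro!: frac_le)
qed (simp add: cond_fun_def)

text \<open>The Gram matrix has trace \<open>K\<close>. The sum of the squared columns has as real
  part the difference of its diagonal entries and as imaginary part twice its off-diagonal entry, so
  its determinant is \<open>(K\<^sup>2 - r\<^sup>2) / 4\<close>.\<close>

lemma cond_number_submatrix:
  fixes B :: "real mat"
  assumes B: "B \<in> carrier_mat 2 N" and unit: "\<And>j. j < N \<Longrightarrow> vec_l2_norm (col B j) = 1"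
    and S: "S \<subseteq> {..<N}"
  shows "cond_number (submatrix B UNIV S) = cond_fun (card S) (cmod (\<Sum>j\<in>S. col_sq B j))"
    and "cmod (\<Sum>j\<in>S. col_sq B j) \<le> card S"
proof -
  define M where "M = submatrix B UNIV S * (submatrix B UNIV S)\<^sup>T"
  define K where "K = real (card S)"
  define r where "r = cmod (\<Sum>j\<in>S. col_sq B j)"
  have unit': "(B $$ (0, j))\<^sup>2 + (B $$ (1, j))\<^sup>2 = 1" "cmod (col_sq B j) = 1" if "j \<in> S" for j
    using norm_col_sq[OF B _ unit, of j] S that by auto
  have "r \<le> (\<Sum>j\<in>S. cmod (col_sq B j))"
    unfolding r_def by (rule norm_sum)
  then have r: "0 \<le> r" "r \<le> K"
    by (simp_all add: unit' K_def r_def)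
  show "cmod (\<Sum>j\<in>S. col_sq B j) \<le> card S"
    using r by (simp add: r_def K_def)
  have M_carrier: "M \<in> carrier_mat 2 2"
    using submatrix_UNIV_carrier[OF B S] by (simp add: M_def)
  note M = gram_submatrix_index[OF B S, folded M_def]
  have "M $$ (0, 0) + M $$ (1, 1) = (\<Sum>j\<in>S. (B $$ (0, j))\<^sup>2 + (B $$ (1, j))\<^sup>2)"
    by (simp add: M sum.distrib power2_eq_square)
  also have "\<dots> = (\<Sum>j\<in>S. 1)"
    by (intro sum.cong unit' refl)
  finally have tr: "M $$ (0, 0) + M $$ (1, 1) = K"
    by (simp add: K_def)
  have "Re (\<Sum>j\<in>S. col_sq B j) = M $$ (0, 0) - M $$ (1, 1)"
    "Im (\<Sum>j\<in>S. col_sq B j) = 2 * M $$ (0, 1)" and sym: "M $$ (1, 0) = M $$ (0, 1)"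
    by (simp_all add: M col_sq_def power2_eq_square sum_subtractf sum_distrib_left sum.distrib mult_ac)
  then have r_sq: "r\<^sup>2 = (M $$ (0, 0) - M $$ (1, 1))\<^sup>2 + (2 * M $$ (0, 1))\<^sup>2"
    by (simp add: r_def cmod_power2)
  have "(M $$ (0, 0) - x) * (M $$ (1, 1) - x) - M $$ (0, 1) * M $$ (1, 0)
      = (x - (K + r) / 2) * (x - (K - r) / 2)" for x
    using r_sq unfolding sym tr[symmetric] by (simp add: power2_eq_square field_simps)
  then have "spectrum M = {(K + r) / 2, (K - r) / 2}"
    using spectrum_2x2[OF M_carrier] by auto
  then have sv: "singular_values (submatrix B UNIV S) = {sqrt ((K + r) / 2), sqrt ((K - r) / 2)}"
    by (simp add: singular_values_def M_def)
  have "sqrt ((K - r) / 2) \<le> sqrt ((K + r) / 2)" using r by simp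
  then have "sigma_max (submatrix B UNIV S) = sqrt ((K + r) / 2)"
    "sigma_min (submatrix B UNIV S) = sqrt ((K - r) / 2)"
    by (simp_all add: sigma_max_def sigma_min_def sv max_def min_def)
  then show "cond_number (submatrix B UNIV S) = cond_fun (card S) (cmod (\<Sum>j\<in>S. col_sq B j))"
    by (simp add: cond_number_def cond_fun_def K_def[symmetric] r_def[symmetric])
qed

section \<open>Comparison of the two configurations\<close>

lemma max_cond_number_mono:
  fixes A B :: "real mat"
  assumes A: "A \<in> carrier_mat 2 N" "\<And>j. j < N \<Longrightarrow> vec_l2_norm (col A j) = 1"
    and B: "B \<in> carrier_mat 2 N" "\<And>j. j < N \<Longrightarrow> vec_l2_norm (col B j) = 1"
    and le: "\<And>S. S \<subseteq> {..<N} \<Longrightarrow> card S = K \<Longrightarrow> cmod (\<Sum>j\<in>S. col_sq A j) \<le> R"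
    and ex: "T \<subseteq> {..<N}" "card T = K" "R \<le> cmod (\<Sum>j\<in>T. col_sq B j)"
  shows "max_cond_number K A \<le> max_cond_number K B"
proof -
  let ?X = "\<lambda>C. {cond_number (submatrix C UNIV S) | S. S \<subseteq> {..<dim_col C} \<and> card S = K}"
  have fin: "finite (?X C)" for C
  proof (rule finite_subset)
    show "?X C \<subseteq> (\<lambda>S. cond_number (submatrix C UNIV S)) ` Pow {..<dim_col C}" by auto
  qed simp
  have "cond_number (submatrix B UNIV T) \<le> Max (?X B)"
    using ex B(1) by (intro Max_ge fin) auto
  moreover have "Max (?X A) \<le> cond_number (submatrix B UNIV T)"
  proof (rule Max.boundedI[OF fin])
    show "?X A \<noteq> {}" using ex A(1) by auto
    fix c assume "c \<in> ?X A"
    then obtain S where S: "S \<subseteq> {..<N}" "card S = K" "c = cond_number (submatrix A UNIV S)"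
      using A(1) by auto
    have "cmod (\<Sum>j\<in>S. col_sq A j) \<le> cmod (\<Sum>j\<in>T. col_sq B j)"
      using le[OF S(1,2)] ex(3) by simp
    then show "c \<le> cond_number (submatrix B UNIV T)"
      using S(2,3) ex(2) cond_number_submatrix[OF A S(1)] cond_number_submatrix[OF B ex(1)]
      by (simp add: cond_fun_mono)
  qed
  ultimately show ?thesis
    unfolding max_cond_number_def by (rule order.trans[rotated])
qed

text \<open>Reducing the angle modulo \<open>pi\<close> has no effect after squaring, which turns
  multiples of \<open>pi\<close> into full turns.\<close>

lemma col_sq_angle_matrix:
  assumes "j < N"
  shows "col_sq (angle_matrix N) j = cis (4 * pi * real j / (real N + 1))"
    and "vec_l2_norm (col (angle_matrix N) j) = 1"
proof -
  define x where "x = 2 * pi * real j / (real N + 1)"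
  have x: "angle N (j + 1) = x - pi * of_int \<lfloor>x / pi\<rfloor>"
    by (simp add: angle_def rmod_def x_def)
  have entries: "angle_matrix N $$ (0, j) = cos (angle N (j + 1))" "angle_matrix N $$ (1, j) = sin (angle N (j + 1))"
    using assms by (simp_all add: angle_matrix_def)
  have "{0..<2} = {0, 1 :: nat}" by auto
  then show "vec_l2_norm (col (angle_matrix N) j) = 1"
    using assms entries by (simp add: vec_l2_norm_def scalar_prod_def angle_matrix_def power2_eq_square[symmetric])
  have "col_sq (angle_matrix N) j = (cis (angle N (j + 1)))\<^sup>2"
    unfolding col_sq_def entries by (simp add: cis.code)
  also have "\<dots> = cis (2 * angle N (j + 1))"
    by (simp add: power2_eq_square cis_mult)
  also have "2 * angle N (j + 1) = 2 * x - 2 * pi * of_int \<lfloor>x / pi\<rfloor>"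
    unfolding x by (simp add: algebra_simps)
  also have "cis \<dots> = cis (2 * x)"
    by (simp add: cis_divide[symmetric] cis_multiple_2pi)
  finally show "col_sq (angle_matrix N) j = cis (4 * pi * real j / (real N + 1))"
    by (simp add: x_def mult.assoc)
qed

theorem theorem4p3:
  fixes N :: nat and B :: "real mat"
  assumes "odd N" and "N \<ge> 7"
    and "B \<in> carrier_mat 2 N"
    and "\<And>j. j < N \<Longrightarrow> vec_l2_norm (col B j) = 1"
  shows "max_cond_number 3 (angle_matrix N) \<le> max_cond_number 3 B"
proof -
  \<comment> \<open>As \<open>N + 1 = 2 * m\<close>, the squared special columns
    \<open>cis (4 * pi * j / (N + 1))\<close> are vertices of a regular
    \<open>m\<close>-gon.\<close>
  define m where "m = (N + 1) div 2"
  have N: "N = 2 * m - 1" "real N + 1 = 2 * real m" and m: "4 \<le> m"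
    using assms(1,2) by (auto simp: m_def elim!: oddE)
  have w: "col_sq B j = cis (Arg (col_sq B j))" if "j < N" for j
  proof -
    have "cmod (col_sq B j) = 1" using norm_col_sq[OF assms(3) that assms(4)[OF that]] by simp
    then have "col_sq B j \<noteq> 0" "sgn (col_sq B j) = col_sq B j" by (auto simp: sgn_eq)
    then show ?thesis using cis_Arg[of "col_sq B j"] by simp
  qed
  have Arg: "- pi < Arg (col_sq B j) \<and> Arg (col_sq B j) \<le> pi" for j
    by (rule Arg_bounded)
  obtain T where T: "T \<subseteq> {..<N}" "card T = 3"
    "5 + 4 * cos (2 * pi / real m) \<le> (cmod (\<Sum>j\<in>T. cis (Arg (col_sq B j))))\<^sup>2"
    using exists_clustered_triple[OF m, of "\<lambda>j. Arg (col_sq B j)"] Arg unfolding N(1) by blast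
  have sum_T: "(\<Sum>j\<in>T. cis (Arg (col_sq B j))) = (\<Sum>j\<in>T. col_sq B j)"
    using T(1) w by (intro sum.cong) auto
  have A: "angle_matrix N \<in> carrier_mat 2 N"
    by (simp add: angle_matrix_def)
  show ?thesis
  proof (rule max_cond_number_mono[OF A _ assms(3,4) _ T(1,2)])
    show "sqrt (5 + 4 * cos (2 * pi / real m)) \<le> cmod (\<Sum>j\<in>T. col_sq B j)"
      using T(3) by (intro real_le_lsqrt) (auto simp: sum_T)
    fix S assume S: "S \<subseteq> {..<N}" "card S = 3"
    have "(\<Sum>j\<in>S. col_sq (angle_matrix N) j) = (\<Sum>j\<in>S. cis (2 * pi * real j / real m))"
      using S(1) by (intro sum.cong) (auto simp: col_sq_angle_matrix N(2) subset_iff mult.assoc)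
    then show "cmod (\<Sum>j\<in>S. col_sq (angle_matrix N) j) \<le> sqrt (5 + 4 * cos (2 * pi / real m))"
      using regular_triple_le[of m S] S m unfolding N(1) by (intro real_le_rsqrt) simp
  qed (use col_sq_angle_matrix in auto)
qed
end
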